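(* Let $u:X\to\mathbb C$ be a measurable function which is bounded away from zero, i.e. there is $\epsilon>0$ with $|u(x)|>\epsilon$ for $\mu$-almost every $x\in X$, and which induces a (bounded) multiplication operator $M_u f=u\cdot f$ on $L(p,q)$. Then the descent $\beta(M_u)$ is equal to $0$.
   Context: $(X,\mathcal A,\mu)$ is a $\sigma$-finite complete measure space. For measurable $h:X\to\mathbb C$ put $\mu_h(s)=\mu(\{x\in X:|h(x)|>s\})$ for $s\ge 0$, $h^*(t)=\inf\{s>0:\mu_h(s)\le t\}$ and $h^{**}(t)=\frac1t\int_0^t h^*(s)\,ds$ for $t>0$. The Lorentz space $L(p,q)$ (for $1<p<\infty$, $1\le q<\infty$, or $1<p\le\infty$, $q=\infty$) is the Banach space of (a.e.-equivalence classes of) measurable $h:X\to\mathbb C$ with $\|h\|_{pq}<\infty$, where $\|h\|_{pq}=\left(\frac qp\int_0^\infty (t^{1/p}h^{**}(t))^q\frac{dt}{t}\right)^{1/q}$ if $1<p<\infty$, $1\le q<\infty$, and $\|h\|_{pq}=\sup_{t>0}t^{1/p}h^{**}(t)$ if $1<p\le\infty$, $q=\infty$. For a bounded linear operator $L$ with range $\mathcal R(L)$, the descent is $\beta(L)=\inf\{k\in\mathbb N\cup\{0\}:\mathcal R(L^{k+1})=\mathcal R(L^k)\}$ (equal to $\infty$ if no such $k$ exists), with $L^0=I$. *)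

theory Defs
  imports "HOL-Analysis.Analysis" "HOL-Library.Extended_Nat"
begin

text \<open>Everything is computed in \<^typ>\<open>ennreal\<close>, so that the rearrangement and the norm may be
  infinite. The infimum of the empty set is \<open>\<infinity>\<close>.\<close>

definition distribution_fun :: "'a measure \<Rightarrow> ('a \<Rightarrow> complex) \<Rightarrow> real \<Rightarrow> ennreal" where
  "distribution_fun M h s = emeasure M {x \<in> space M. cmod (h x) > s}"

definition rearrangement :: "'a measure \<Rightarrow> ('a \<Rightarrow> complex) \<Rightarrow> real \<Rightarrow> ennreal" where
  "rearrangement M h t = Inf {ennreal s | s. s > 0 \<and> distribution_fun M h s \<le> ennreal t}"

definition max_rearrangement :: "'a measure \<Rightarrow> ('a \<Rightarrow> complex) \<Rightarrow> real \<Rightarrow> ennreal" where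
  "max_rearrangement M h t =
     ennreal (1 / t) * (\<integral>\<^sup>+ s \<in> {0<..<t}. rearrangement M h s \<partial>lborel)"

text \<open>Real powers on \<open>[0, \<infinity>]\<close>; only used with exponents \<open>r > 0\<close>, whence \<open>\<infinity>\<^sup>r = \<infinity>\<close>.\<close>

definition ennreal_powr :: "ennreal \<Rightarrow> real \<Rightarrow> ennreal" where
  "ennreal_powr x r = (if x = \<infinity> then \<infinity> else ennreal (enn2real x powr r))"

definition lorentz_indices :: "ennreal \<Rightarrow> ennreal \<Rightarrow> bool" where
  "lorentz_indices p q \<longleftrightarrow>
     (1 < p \<and> p < \<infinity> \<and> 1 \<le> q \<and> q < \<infinity>) \<or> (1 < p \<and> p \<le> \<infinity> \<and> q = \<infinity>)"

text \<open>For \<open>p = \<infinity>\<close> the exponent \<open>enn2real (1 / p)\<close> is \<open>0\<close>, so the weight \<open>t powr 0\<close> is \<open>1\<close> for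
  \<open>t > 0\<close>. For indices not satisfying \<^const>\<open>lorentz_indices\<close> the value is meaningless.\<close>

definition lorentz_norm :: "'a measure \<Rightarrow> ennreal \<Rightarrow> ennreal \<Rightarrow> ('a \<Rightarrow> complex) \<Rightarrow> ennreal" where
  "lorentz_norm M p q h =
     (if q = \<infinity>
      then (SUP t \<in> {0<..}. ennreal (t powr enn2real (1 / p)) * max_rearrangement M h t)
      else ennreal_powr
        ((q / p) * (\<integral>\<^sup>+ t \<in> {0<..}.
           ennreal_powr (ennreal (t powr enn2real (1 / p)) * max_rearrangement M h t) (enn2real q)
             * ennreal (1 / t) \<partial>lborel))
        (1 / enn2real q))"

definition ae_eq :: "'a measure \<Rightarrow> (('a \<Rightarrow> complex) \<times> ('a \<Rightarrow> complex)) set" where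
  "ae_eq M = {(f, g). f \<in> borel_measurable M \<and> g \<in> borel_measurable M \<and> (AE x in M. f x = g x)}"

definition lorentz_functions :: "'a measure \<Rightarrow> ennreal \<Rightarrow> ennreal \<Rightarrow> ('a \<Rightarrow> complex) set" where
  "lorentz_functions M p q = {h \<in> borel_measurable M. lorentz_norm M p q h < \<infinity>}"

definition lorentz_space :: "'a measure \<Rightarrow> ennreal \<Rightarrow> ennreal \<Rightarrow> ('a \<Rightarrow> complex) set set" where
  "lorentz_space M p q = lorentz_functions M p q // ae_eq M"

text \<open>The norm and the linear operations on classes are lifted from representatives; the lemmas
  below show that they do not depend on the choice of representatives.\<close>

definition class_norm :: "'a measure \<Rightarrow> ennreal \<Rightarrow> ennreal \<Rightarrow> ('a \<Rightarrow> complex) set \<Rightarrow> ennreal" where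
  "class_norm M p q F = the_elem (lorentz_norm M p q ` F)"

definition class_lincomb ::
    "'a measure \<Rightarrow> complex \<Rightarrow> ('a \<Rightarrow> complex) set \<Rightarrow> complex \<Rightarrow> ('a \<Rightarrow> complex) set \<Rightarrow> ('a \<Rightarrow> complex) set"
  where
  "class_lincomb M a F b G = (\<Union>f\<in>F. \<Union>g\<in>G. ae_eq M `` {\<lambda>x. a * f x + b * g x})"

definition mult_op :: "'a measure \<Rightarrow> ('a \<Rightarrow> complex) \<Rightarrow> ('a \<Rightarrow> complex) set \<Rightarrow> ('a \<Rightarrow> complex) set" where
  "mult_op M u F = (\<Union>f\<in>F. ae_eq M `` {\<lambda>x. u x * f x})"

definition lorentz_bounded_linear ::
    "'a measure \<Rightarrow> ennreal \<Rightarrow> ennreal \<Rightarrow> (('a \<Rightarrow> complex) set \<Rightarrow> ('a \<Rightarrow> complex) set) \<Rightarrow> bool" where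
  "lorentz_bounded_linear M p q L \<longleftrightarrow>
     (\<forall>F \<in> lorentz_space M p q. L F \<in> lorentz_space M p q) \<and>
     (\<forall>F \<in> lorentz_space M p q. \<forall>G \<in> lorentz_space M p q. \<forall>a b.
        L (class_lincomb M a F b G) = class_lincomb M a (L F) b (L G)) \<and>
     (\<exists>C::real. \<forall>F \<in> lorentz_space M p q. class_norm M p q (L F) \<le> ennreal C * class_norm M p q F)"

text \<open>Descent of a self-map \<open>L\<close> of \<open>V\<close>: the range of \<open>L\<^sup>k\<close> is \<open>(L ^^ k) ` V\<close>, and the infimum
  of the empty set in \<^typ>\<open>enat\<close> is \<open>\<infinity>\<close>.\<close>

definition descent :: "'v set \<Rightarrow> ('v \<Rightarrow> 'v) \<Rightarrow> enat" where
  "descent V L = Inf {enat k | k. (L ^^ (k + 1)) ` V = (L ^^ k) ` V}"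

lemma equiv_ae_eq: "equiv (borel_measurable M) (ae_eq M)"
proof (rule equivI)
  show "ae_eq M \<subseteq> borel_measurable M \<times> borel_measurable M" by (auto simp: ae_eq_def)
  show "refl_on (borel_measurable M) (ae_eq M)" by (simp add: refl_on_def ae_eq_def)
  show "sym (ae_eq M)" by (simp add: sym_def ae_eq_def eq_commute)
  show "trans (ae_eq M)"
  proof (rule transI)
    fix f g h assume "(f, g) \<in> ae_eq M" "(g, h) \<in> ae_eq M"
    then have "f \<in> borel_measurable M" "h \<in> borel_measurable M"
      and "AE x in M. f x = g x" "AE x in M. g x = h x" by (simp_all add: ae_eq_def)
    moreover from this(3,4) have "AE x in M. f x = h x" by eventually_elim simp
    ultimately show "(f, h) \<in> ae_eq M" by (simp add: ae_eq_def)
  qed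
qed

lemma ae_eq_class_eq: "(f, g) \<in> ae_eq M \<Longrightarrow> ae_eq M `` {f} = ae_eq M `` {g}"
  by (rule equiv_class_eq[OF equiv_ae_eq])

lemma lorentz_norm_cong:
  assumes "(f, g) \<in> ae_eq M"
  shows "lorentz_norm M p q f = lorentz_norm M p q g"
proof -
  have [measurable]: "f \<in> borel_measurable M" "g \<in> borel_measurable M"
    and ae: "AE x in M. f x = g x" using assms by (simp_all add: ae_eq_def)
  have "distribution_fun M f = distribution_fun M g"
  proof
    fix s
    from ae have "AE x in M. x \<in> {x \<in> space M. cmod (f x) > s} \<longleftrightarrow> x \<in> {x \<in> space M. cmod (g x) > s}"
      by eventually_elim simp
    then show "distribution_fun M f s = distribution_fun M g s"
      unfolding distribution_fun_def by (rule emeasure_eq_AE) measurable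
  qed
  then show ?thesis
    unfolding lorentz_norm_def max_rearrangement_def rearrangement_def by simp
qed

lemma class_norm_class:
  assumes "f \<in> borel_measurable M"
  shows "class_norm M p q (ae_eq M `` {f}) = lorentz_norm M p q f"
proof -
  have "lorentz_norm M p q ` (ae_eq M `` {f}) = (\<lambda>_. lorentz_norm M p q f) ` (ae_eq M `` {f})"
    by (intro image_cong refl lorentz_norm_cong[symmetric]) simp
  also have "\<dots> = {lorentz_norm M p q f}"
    by (rule image_constant[where x = f]) (use assms in \<open>simp add: ae_eq_def\<close>)
  finally show ?thesis by (simp add: class_norm_def)
qed

lemma class_lincomb_class:
  assumes f: "f \<in> borel_measurable M" and g: "g \<in> borel_measurable M"
  shows "class_lincomb M a (ae_eq M `` {f}) b (ae_eq M `` {g}) =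
    ae_eq M `` {\<lambda>x. a * f x + b * g x}"
  unfolding class_lincomb_def
proof (rule UN_equiv_class2[OF equiv_ae_eq equiv_ae_eq _ f g], rule congruent2I')
  fix f f' g g' assume "(f, f') \<in> ae_eq M" "(g, g') \<in> ae_eq M"
  then have [measurable]: "f \<in> borel_measurable M" "f' \<in> borel_measurable M"
      "g \<in> borel_measurable M" "g' \<in> borel_measurable M"
    and ae: "AE x in M. f x = f' x" "AE x in M. g x = g' x" by (simp_all add: ae_eq_def)
  from ae have "AE x in M. a * f x + b * g x = a * f' x + b * g' x" by eventually_elim simp
  then show "ae_eq M `` {\<lambda>x. a * f x + b * g x} = ae_eq M `` {\<lambda>x. a * f' x + b * g' x}"
    by (intro ae_eq_class_eq) (simp add: ae_eq_def)
qed

lemma mult_op_class: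
  assumes u [measurable]: "u \<in> borel_measurable M" and f: "f \<in> borel_measurable M"
  shows "mult_op M u (ae_eq M `` {f}) = ae_eq M `` {\<lambda>x. u x * f x}"
  unfolding mult_op_def
proof (rule UN_equiv_class[OF equiv_ae_eq _ f], rule congruentI)
  fix f f' assume "(f, f') \<in> ae_eq M"
  then have [measurable]: "f \<in> borel_measurable M" "f' \<in> borel_measurable M"
    and ae: "AE x in M. f x = f' x" by (simp_all add: ae_eq_def)
  from ae have "AE x in M. u x * f x = u x * f' x" by eventually_elim simp
  then show "ae_eq M `` {\<lambda>x. u x * f x} = ae_eq M `` {\<lambda>x. u x * f' x}"
    by (intro ae_eq_class_eq) (simp add: ae_eq_def)
qed

lemma mult_op_lincomb:
  assumes u [measurable]: "u \<in> borel_measurable M"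
    and F: "F \<in> lorentz_space M p q" and G: "G \<in> lorentz_space M p q"
  shows "mult_op M u (class_lincomb M a F b G) = class_lincomb M a (mult_op M u F) b (mult_op M u G)"
proof -
  obtain f where f [measurable]: "f \<in> borel_measurable M" and F_eq: "F = ae_eq M `` {f}"
    using F unfolding lorentz_space_def lorentz_functions_def by (elim quotientE CollectE conjE) (rule that)
  obtain g where g [measurable]: "g \<in> borel_measurable M" and G_eq: "G = ae_eq M `` {g}"
    using G unfolding lorentz_space_def lorentz_functions_def by (elim quotientE CollectE conjE) (rule that)
  have "mult_op M u (class_lincomb M a F b G) = ae_eq M `` {\<lambda>x. u x * (a * f x + b * g x)}"
    unfolding F_eq G_eq class_lincomb_class[OF f g] by (rule mult_op_class) measurable
  also have "(\<lambda>x. u x * (a * f x + b * g x)) = (\<lambda>x. a * (u x * f x) + b * (u x * g x))"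
    by (simp add: algebra_simps)
  also have "ae_eq M `` {\<dots>} = class_lincomb M a (mult_op M u F) b (mult_op M u G)"
    unfolding F_eq G_eq mult_op_class[OF u f] mult_op_class[OF u g]
    by (rule class_lincomb_class[symmetric]) measurable
  finally show ?thesis .
qed

end

theory Submission
  imports Defs
begin

text \<open>If \<open>|u| > \<epsilon>\<close> almost everywhere, then \<open>|f / u| \<le> |f| / \<epsilon>\<close>. Domination up to a positive factor
  passes to the distribution function, the rearrangement, its averages and the norm, so \<open>f / u\<close>
  lies in the Lorentz space together with \<open>f\<close>. Hence \<open>M\<^sub>u\<close> is surjective.\<close>

lemma distribution_fun_AE_le:
  assumes c: "c > 0" and f [measurable]: "f \<in> borel_measurable M"
    and le: "AE x in M. cmod (g x) \<le> c * cmod (f x)"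
  shows "distribution_fun M g (c * s) \<le> distribution_fun M f s"
  unfolding distribution_fun_def
proof (rule emeasure_mono_AE)
  show "AE x in M. x \<in> {x \<in> space M. c * s < cmod (g x)} \<longrightarrow> x \<in> {x \<in> space M. s < cmod (f x)}"
    using le
  proof eventually_elim
    case (elim x)
    then have "c * s < cmod (g x) \<Longrightarrow> c * s < c * cmod (f x)" by linarith
    with c show ?case by simp
  qed
qed measurable

lemma rearrangement_AE_le:
  assumes c: "c > 0" and f: "f \<in> borel_measurable M"
    and le: "AE x in M. cmod (g x) \<le> c * cmod (f x)"
  shows "rearrangement M g t \<le> ennreal c * rearrangement M f t"
proof -
  \<comment> \<open>With the factor moved to the left, the claim says that a number is a lower bound
    of the set whose infimum defines \<open>rearrangement M f t\<close>, so each admissible level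
    can be treated separately.\<close>
  have "inverse (ennreal c) * rearrangement M g t \<le> rearrangement M f t"
    unfolding rearrangement_def[of M f]
  proof (rule Inf_greatest, clarify)
    fix s :: real assume s: "s > 0" and t: "distribution_fun M f s \<le> ennreal t"
    \<comment> \<open>If the level \<open>s\<close> is admissible for \<open>f\<close>, then
      \<open>c * s\<close> is admissible for \<open>g\<close>.\<close>
    have "distribution_fun M g (c * s) \<le> ennreal t"
      using distribution_fun_AE_le[OF c f le] t by (rule order_trans)
    with s c have "rearrangement M g t \<le> ennreal (c * s)"
      unfolding rearrangement_def by (intro Inf_lower) auto
    then have "inverse (ennreal c) * rearrangement M g t \<le> inverse (ennreal c) * ennreal (c * s)"
      by (rule mult_left_mono) simp
    also have "\<dots> = ennreal s"
      using c s by (simp add: inverse_ennreal flip: ennreal_mult)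
    finally show "inverse (ennreal c) * rearrangement M g t \<le> ennreal s" .
  qed
  then have "ennreal c * (inverse (ennreal c) * rearrangement M g t) \<le> ennreal c * rearrangement M f t"
    by (rule mult_left_mono) simp
  \<comment> \<open>Cancellation is legitimate because \<open>ennreal c\<close> is neither 0 nor
    infinite.\<close>
  moreover have "ennreal c * inverse (ennreal c) = 1"
    using c by (simp add: inverse_ennreal flip: ennreal_mult)
  ultimately show ?thesis by (simp flip: mult.assoc)
qed

text \<open>Stated for arbitrary \<open>f\<close>, so that integrals of rearrangements can be
  compared without first proving them measurable. The integral is a supremum over simple functions
  below the integrand, and dividing such a function by \<open>c\<close> gives a simple function
  below \<open>f\<close>.\<close>

lemma nn_integral_cmult_le:
  fixes f :: "'b \<Rightarrow> ennreal"
  assumes c: "c > 0"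
  shows "(\<integral>\<^sup>+ x. ennreal c * f x \<partial>M) \<le> ennreal c * (\<integral>\<^sup>+ x. f x \<partial>M)"
  unfolding nn_integral_def[of M "\<lambda>x. ennreal c * f x"]
proof (rule SUP_least, clarify)
  fix g assume g: "simple_function M g" and le: "g \<le> (\<lambda>x. ennreal c * f x)"
  have cancel: "ennreal c * inverse (ennreal c) = 1"
    using c by (simp add: inverse_ennreal flip: ennreal_mult)
  define h where "h = (\<lambda>x. inverse (ennreal c) * g x)"
  have h: "simple_function M h" unfolding h_def using g by (intro simple_function_mult) auto
  have "integral\<^sup>S M g = integral\<^sup>S M (\<lambda>x. ennreal c * h x)"
    by (simp add: h_def cancel flip: mult.assoc)
  also have "\<dots> = ennreal c * integral\<^sup>S M h"
    using h by (rule simple_integral_mult)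
  also have "integral\<^sup>S M h = integral\<^sup>N M h"
    using h by (rule nn_integral_eq_simple_integral[symmetric])
  also have "\<dots> \<le> integral\<^sup>N M f"
  proof (rule nn_integral_mono)
    fix x
    have "h x \<le> inverse (ennreal c) * (ennreal c * f x)"
      unfolding h_def using le by (intro mult_left_mono) (auto simp: le_fun_def)
    also have "\<dots> = f x"
      using cancel by (simp add: mult.commute[of "inverse _"] flip: mult.assoc)
    finally show "h x \<le> f x" .
  qed
  finally show "integral\<^sup>S M g \<le> ennreal c * integral\<^sup>N M f"
    by (simp add: mult_left_mono)
qed

lemma max_rearrangement_AE_le:
  assumes c: "c > 0" and f: "f \<in> borel_measurable M"
    and le: "AE x in M. cmod (g x) \<le> c * cmod (f x)"
  shows "max_rearrangement M g t \<le> ennreal c * max_rearrangement M f t"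
proof -
  have "(\<integral>\<^sup>+ s \<in> {0<..<t}. rearrangement M g s \<partial>lborel)
      \<le> (\<integral>\<^sup>+ s. ennreal c * (rearrangement M f s * indicator {0<..<t} s) \<partial>lborel)"
    by (intro nn_integral_mono)
      (simp add: rearrangement_AE_le[OF c f le] mult_right_mono flip: mult.assoc)
  also have "\<dots> \<le> ennreal c * (\<integral>\<^sup>+ s \<in> {0<..<t}. rearrangement M f s \<partial>lborel)"
    by (rule nn_integral_cmult_le[OF c])
  finally have "max_rearrangement M g t \<le>
      ennreal (1 / t) * (ennreal c * (\<integral>\<^sup>+ s \<in> {0<..<t}. rearrangement M f s \<partial>lborel))"
    unfolding max_rearrangement_def by (rule mult_left_mono) simp
  then show ?thesis
    by (simp only: max_rearrangement_def mult.left_commute)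
qed

lemma ennreal_powr_mono:
  assumes "x \<le> y" "r \<ge> 0"
  shows "ennreal_powr x r \<le> ennreal_powr y r"
  using assms
  by (auto simp: ennreal_powr_def top_unique less_top intro!: ennreal_leI powr_mono2 enn2real_mono)

text \<open>As \<open>ennreal c\<close> is positive and finite, the product is infinite exactly when
  \<open>x\<close> is. Then both sides are infinite because \<open>c powr r\<close> is positive;
  otherwise this is the rule for real powers.\<close>

lemma ennreal_powr_cmult:
  assumes "c > 0"
  shows "ennreal_powr (ennreal c * x) r = ennreal (c powr r) * ennreal_powr x r"
  using assms
  by (cases x) (auto simp: ennreal_powr_def ennreal_mult_eq_top_iff ennreal_mult_top enn2real_mult
      powr_mult ennreal_mult)

lemma ennreal_powr_less_top_iff: "ennreal_powr x r < \<infinity> \<longleftrightarrow> x < \<infinity>"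
  by (simp add: ennreal_powr_def less_top)

text \<open>Finiteness is what membership in the Lorentz space asks for. Aiming at it instead of a
  norm inequality allows the outer root to be dropped when \<open>q\<close> is finite.\<close>

lemma lorentz_norm_AE_le_finite:
  assumes c: "c > 0" and f: "f \<in> borel_measurable M"
    and le: "AE x in M. cmod (g x) \<le> c * cmod (f x)"
    and fin: "lorentz_norm M p q f < \<infinity>"
  shows "lorentz_norm M p q g < \<infinity>"
proof -
  define w where "w h t = ennreal (t powr enn2real (1 / p)) * max_rearrangement M h t" for h t
  have w: "w g t \<le> ennreal c * w f t" for t
  proof -
    have "w g t \<le> ennreal (t powr enn2real (1 / p)) * (ennreal c * max_rearrangement M f t)"
      unfolding w_def by (rule mult_left_mono[OF max_rearrangement_AE_le[OF c f le]]) simp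
    then show ?thesis by (simp only: w_def mult.left_commute)
  qed
  show ?thesis
  proof (cases "q = \<infinity>")
    case True
    have "(SUP t \<in> {0<..}. w g t) \<le> ennreal c * (SUP t \<in> {0<..}. w f t)"
      by (intro SUP_least order_trans[OF w] mult_left_mono SUP_upper) auto
    also have "\<dots> < \<infinity>"
      using fin True by (simp add: lorentz_norm_def w_def ennreal_mult_less_top)
    finally show ?thesis
      using True by (simp add: lorentz_norm_def w_def)
  next
    case False
    define r where "r = enn2real q"
    define I where
      "I h = (\<integral>\<^sup>+ t \<in> {0<..}. ennreal_powr (w h t) r * ennreal (1 / t) \<partial>lborel)" for h
    \<comment> \<open>The outer power is finite exactly when its argument is, so only the weighted
      integral has to be compared.\<close>
    have norm: "lorentz_norm M p q h < \<infinity> \<longleftrightarrow> (q / p) * I h < \<infinity>" for h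
      using False by (simp only: lorentz_norm_def if_False ennreal_powr_less_top_iff I_def w_def r_def)
    have "ennreal_powr (w g t) r \<le> ennreal (c powr r) * ennreal_powr (w f t) r" for t
      using ennreal_powr_mono[OF w, of r t] by (simp add: ennreal_powr_cmult c r_def)
    then have "I g \<le> (\<integral>\<^sup>+ t. ennreal (c powr r) *
        (ennreal_powr (w f t) r * ennreal (1 / t) * indicator {0<..} t) \<partial>lborel)"
      unfolding I_def by (intro nn_integral_mono) (simp add: mult_right_mono flip: mult.assoc)
    also have "\<dots> \<le> ennreal (c powr r) * I f"
      unfolding I_def using c by (intro nn_integral_cmult_le) simp
    finally have "(q / p) * I g \<le> ennreal (c powr r) * ((q / p) * I f)"
      by (simp add: mult_left_mono mult.left_commute)
    also have "\<dots> < \<infinity>"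
      using fin unfolding norm by (simp add: ennreal_mult_less_top)
    finally show ?thesis unfolding norm .
  qed
qed

lemma mult_op_surj:
  assumes u [measurable]: "u \<in> borel_measurable M"
    and \<epsilon>: "\<epsilon> > 0" "AE x in M. cmod (u x) > \<epsilon>"
  shows "lorentz_space M p q \<subseteq> mult_op M u ` lorentz_space M p q"
proof
  fix F assume "F \<in> lorentz_space M p q"
  then obtain f where f [measurable]: "f \<in> borel_measurable M"
    and fin: "lorentz_norm M p q f < \<infinity>" and F: "F = ae_eq M `` {f}"
    unfolding lorentz_space_def lorentz_functions_def by (auto elim!: quotientE)
  \<comment> \<open>Where \<open>u\<close> vanishes, division yields 0. This concerns only a null
    set, so \<open>g\<close> still represents a preimage of the class of \<open>f\<close>.\<close>
  define g where "g = (\<lambda>x. f x / u x)"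
  have g [measurable]: "g \<in> borel_measurable M" unfolding g_def by measurable
  have "AE x in M. cmod (g x) \<le> 1 / \<epsilon> * cmod (f x)"
    using \<epsilon>(2)
  proof eventually_elim
    case (elim x)
    with \<epsilon>(1) have "cmod (f x) / cmod (u x) \<le> cmod (f x) / \<epsilon>"
      by (intro divide_left_mono mult_pos_pos) auto
    then show ?case by (simp add: g_def norm_divide)
  qed
  then have "lorentz_norm M p q g < \<infinity>"
    by (rule lorentz_norm_AE_le_finite[OF _ f _ fin, rotated]) (use \<epsilon>(1) in simp)
  with g have G: "ae_eq M `` {g} \<in> lorentz_space M p q"
    unfolding lorentz_space_def lorentz_functions_def by (intro quotientI) simp
  have "AE x in M. f x = u x * g x"
    using \<epsilon>(2) by eventually_elim (use \<epsilon>(1) in \<open>auto simp: g_def\<close>)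
  then have "F = mult_op M u (ae_eq M `` {g})"
    unfolding F mult_op_class[OF u g] by (intro ae_eq_class_eq) (simp add: ae_eq_def)
  with G show "F \<in> mult_op M u ` lorentz_space M p q" by blast
qed

theorem theorem3p4:
  fixes M :: "'a measure" and p q :: ennreal and u :: "'a \<Rightarrow> complex"
  assumes "sigma_finite_measure M" and "complete_measure M"
    and "lorentz_indices p q"
    and "u \<in> borel_measurable M"
    and "\<exists>\<epsilon>>0. AE x in M. cmod (u x) > \<epsilon>"
    and "lorentz_bounded_linear M p q (mult_op M u)"
  shows "descent (lorentz_space M p q) (mult_op M u) = 0"
proof -
  let ?V = "lorentz_space M p q"
  \<comment> \<open>This inclusion is part of the assumption that \<open>u\<close> induces an
    operator on the space; the reverse one is \<open>mult_op_surj\<close>.\<close>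
  have "mult_op M u ` ?V \<subseteq> ?V"
    using assms(6) by (auto simp: lorentz_bounded_linear_def)
  with assms(4,5) have "mult_op M u ` ?V = ?V"
    using mult_op_surj by (metis subset_antisym)
  \<comment> \<open>The zeroth power is the identity, so surjectivity is the descent condition at
    \<open>k = 0\<close>.\<close>
  then have "(mult_op M u ^^ (0 + 1)) ` ?V = (mult_op M u ^^ 0) ` ?V"
    by simp
  then have "descent ?V (mult_op M u) \<le> enat 0"
    unfolding descent_def by (intro Inf_lower) blast
  then show ?thesis by (simp add: zero_enat_def[symmetric])
qed

end
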